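(* Let $M$ be a $\Gamma$-module. Then $$H_0(\Gamma/\mathcal P,M)=M_{\mathcal E}=M_{\mathcal E^*}.$$ (That is, the canonical maps from $M$ onto $H_0(\Gamma/\mathcal P,M)=M\otimes_\Gamma\mathcal P$, $m\mapsto m\otimes1$, onto $M_{\mathcal E}$ and onto $M_{\mathcal E^*}$ all have the same kernel.)
   Context: $\mathrm{Emb}$ is the inverse monoid of partially defined injections $f:\mathbb N\supset\mathrm{dom}f\to\mathbb N$, with inverse $f^\dagger:\mathrm{ran}f\to\mathrm{dom}f$; $\mathcal E=\{f\in\mathrm{Emb}:\mathrm{dom}f=\mathbb N\}$ and $\mathcal E^*=\{f\in\mathcal E:\mathrm{ran}f=\mathbb N\}$. $\Gamma$ is the ring of integer matrices $(A_{ij})_{i,j\in\mathbb N}$ with finitely many distinct entries and a uniform finite bound on the number of nonzero entries in each row and column; $\mathcal P\subset\Gamma$ is the subring of diagonal matrices, identified with sequences $\mathbb N\to\mathbb Z$ with finitely many values. $f\in\mathrm{Emb}$ gives $U_f\in\Gamma$, $(U_f)_{ij}=1$ if $j\in\mathrm{dom}f$ and $f(j)=i$, $0$ otherwise; $\Gamma$ is the quotient of $\mathbb Z[\mathrm{Emb}]$ by the relations $p_{A\sqcup B}=p_A+p_B$ for disjoint $A,B\subset\mathbb N$, $p_A$ the identity of $A$. $\mathcal P$ is a left $\Gamma$-module via $(U_f\cdot p)_n=p_m$ if $n=f(m)$, and $0$ if $n\notin\mathrm{ran}f$. For a left $\Gamma$-module $M$ write $f_*(m)=U_fm$; $M$ is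 viewed as a right module via $m\cdot U_f=(f^\dagger)_*(m)$ (transposition of matrices), and $H_*(\Gamma/\mathcal P,M)=\mathrm{Tor}_*^\Gamma(M,\mathcal P)$, so $H_0(\Gamma/\mathcal P,M)=M\otimes_\Gamma\mathcal P$. For $\mathfrak S\in\{\mathcal E,\mathcal E^*\}$, $M_{\mathfrak S}=M/\mathrm{span}_{\mathbb Z}\{m-f_*(m):m\in M,\ f\in\mathfrak S\}$. *)

theory Defs
  imports "HOL-Algebra.Algebra" "HOL-Library.Groups_Big_Fun"
begin

text \<open>Partially defined injections of \<open>\<nat>\<close>.\<close>

definition Emb :: "(nat \<rightharpoonup> nat) set" where
  "Emb = {f. inj_on f (dom f)}"

definition pinv :: "(nat \<rightharpoonup> nat) \<Rightarrow> (nat \<rightharpoonup> nat)" where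
  "pinv f = (\<lambda>n. if n \<in> ran f then Some (THE m. f m = Some n) else None)"

definition Emb_total :: "(nat \<rightharpoonup> nat) set" where
  "Emb_total = {f \<in> Emb. dom f = UNIV}"

definition Emb_bij :: "(nat \<rightharpoonup> nat) set" where
  "Emb_bij = {f \<in> Emb_total. ran f = UNIV}"


text \<open>
  The ring \<open>\<Gamma>\<close>. The sums below have finite support when the matrix on the left lies in \<open>\<Gamma>\<close>,
  so that \<open>Sum_any\<close> (which is 0 on functions of infinite support) is the true sum.
\<close>

type_synonym imat = "nat \<Rightarrow> nat \<Rightarrow> int"

definition finite_entries :: "imat \<Rightarrow> bool" where
  "finite_entries A \<longleftrightarrow> finite {A i j | i j. True}"

definition bounded_rows :: "imat \<Rightarrow> bool" where
  "bounded_rows A \<longleftrightarrow> (\<exists>N. \<forall>i. finite {j. A i j \<noteq> 0} \<and> card {j. A i j \<noteq> 0} \<le> N)"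

definition mat_transp :: "imat \<Rightarrow> imat" where
  "mat_transp A = (\<lambda>i j. A j i)"

definition mat_vec :: "imat \<Rightarrow> (nat \<Rightarrow> int) \<Rightarrow> (nat \<Rightarrow> int)" where
  "mat_vec A v = (\<lambda>i. Sum_any (\<lambda>j. A i j * v j))"

definition mat_mult :: "imat \<Rightarrow> imat \<Rightarrow> imat" where
  "mat_mult A B = (\<lambda>i k. Sum_any (\<lambda>j. A i j * B j k))"

definition Gamma :: "imat ring" where
  "Gamma = \<lparr>carrier = {A. finite_entries A \<and> bounded_rows A \<and> bounded_rows (mat_transp A)},
     monoid.mult = mat_mult, one = (\<lambda>i j. if i = j then 1 else 0),
     ring.zero = (\<lambda>i j. 0), add = (\<lambda>A B i j. A i j + B i j)\<rparr>"

definition U :: "(nat \<rightharpoonup> nat) \<Rightarrow> imat" where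
  "U f = (\<lambda>i j. if f j = Some i then 1 else 0)"


text \<open>
  The \<open>\<Gamma>\<close>-module of sequences with finitely many values. The action is multiplication of
  a matrix with a column vector; by \<open>mat_vec_U\<close> below, the entry of \<open>U f \<cdot> p\<close> at \<open>n\<close> is \<open>p m\<close>
  if \<open>n = f m\<close>, and 0 if \<open>n\<close> is not in the range of \<open>f\<close>.
\<close>

definition P_mod :: "(imat, nat \<Rightarrow> int) module" where
  "P_mod = \<lparr>carrier = {p. finite (range p)},
     monoid.mult = (\<lambda>p q n. p n * q n), one = (\<lambda>n. 1),
     ring.zero = (\<lambda>n. 0), add = (\<lambda>p q n. p n + q n), smult = mat_vec\<rparr>"

definition diag :: "(nat \<Rightarrow> int) \<Rightarrow> imat" where
  "diag p = (\<lambda>i j. if i = j then p i else 0)"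


text \<open>
  Unital left modules over a ring that need not be commutative (the locale \<^locale>\<open>module\<close>
  assumes commutativity). As there, the fields \<open>mult\<close> and \<open>one\<close> of \<open>M\<close> are irrelevant.
\<close>

locale left_module = R?: ring R + M?: abelian_group M
  for R :: "('a, 'c) ring_scheme" (structure) and M :: "('a, 'b, 'd) module_scheme" (structure) +
  assumes smult_closed [simp, intro]:
      "\<lbrakk>a \<in> carrier R; x \<in> carrier M\<rbrakk> \<Longrightarrow> a \<odot>\<^bsub>M\<^esub> x \<in> carrier M"
    and smult_l_distr:
      "\<lbrakk>a \<in> carrier R; b \<in> carrier R; x \<in> carrier M\<rbrakk> \<Longrightarrow>
        (a \<oplus> b) \<odot>\<^bsub>M\<^esub> x = a \<odot>\<^bsub>M\<^esub> x \<oplus>\<^bsub>M\<^esub> b \<odot>\<^bsub>M\<^esub> x"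
    and smult_r_distr:
      "\<lbrakk>a \<in> carrier R; x \<in> carrier M; y \<in> carrier M\<rbrakk> \<Longrightarrow>
        a \<odot>\<^bsub>M\<^esub> (x \<oplus>\<^bsub>M\<^esub> y) = a \<odot>\<^bsub>M\<^esub> x \<oplus>\<^bsub>M\<^esub> a \<odot>\<^bsub>M\<^esub> y"
    and smult_assoc1:
      "\<lbrakk>a \<in> carrier R; b \<in> carrier R; x \<in> carrier M\<rbrakk> \<Longrightarrow>
        (a \<otimes> b) \<odot>\<^bsub>M\<^esub> x = a \<odot>\<^bsub>M\<^esub> (b \<odot>\<^bsub>M\<^esub> x)"
    and smult_one [simp]: "x \<in> carrier M \<Longrightarrow> \<one> \<odot>\<^bsub>M\<^esub> x = x"


text \<open>
  The tensor product over \<open>R\<close> of a right module, given by the abelian group \<open>M\<close> with the right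
  action \<open>act\<close>, and a left module \<open>N\<close>: the free abelian group on pairs modulo the subgroup
  generated by the biadditivity and balancing relations.
\<close>

definition tensor_relations ::
  "('a, 'c) ring_scheme \<Rightarrow> ('b, 'd) ring_scheme \<Rightarrow> ('b \<Rightarrow> 'a \<Rightarrow> 'b) \<Rightarrow>
   ('a, 'n, 'e) module_scheme \<Rightarrow> ('b \<times> 'n \<Rightarrow>\<^sub>0 int) set" where
  "tensor_relations R M act N =
     {frag_of (x \<oplus>\<^bsub>M\<^esub> y, p) - frag_of (x, p) - frag_of (y, p) | x y p.
        x \<in> carrier M \<and> y \<in> carrier M \<and> p \<in> carrier N} \<union>
     {frag_of (x, p \<oplus>\<^bsub>N\<^esub> q) - frag_of (x, p) - frag_of (x, q) | x p q.
        x \<in> carrier M \<and> p \<in> carrier N \<and> q \<in> carrier N} \<union>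
     {frag_of (act x a, p) - frag_of (x, a \<odot>\<^bsub>N\<^esub> p) | x a p.
        x \<in> carrier M \<and> a \<in> carrier R \<and> p \<in> carrier N}"

definition tensor_null ::
  "('a, 'c) ring_scheme \<Rightarrow> ('b, 'd) ring_scheme \<Rightarrow> ('b \<Rightarrow> 'a \<Rightarrow> 'b) \<Rightarrow>
   ('a, 'n, 'e) module_scheme \<Rightarrow> ('b \<times> 'n \<Rightarrow>\<^sub>0 int) set" where
  "tensor_null R M act N =
     generate (free_Abelian_group (carrier M \<times> carrier N)) (tensor_relations R M act N)"

definition tensor_product ::
  "('a, 'c) ring_scheme \<Rightarrow> ('b, 'd) ring_scheme \<Rightarrow> ('b \<Rightarrow> 'a \<Rightarrow> 'b) \<Rightarrow>
   ('a, 'n, 'e) module_scheme \<Rightarrow> ('b \<times> 'n \<Rightarrow>\<^sub>0 int) set monoid" where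
  "tensor_product R M act N =
     free_Abelian_group (carrier M \<times> carrier N) Mod tensor_null R M act N"

definition tensor_elem ::
  "('a, 'c) ring_scheme \<Rightarrow> ('b, 'd) ring_scheme \<Rightarrow> ('b \<Rightarrow> 'a \<Rightarrow> 'b) \<Rightarrow>
   ('a, 'n, 'e) module_scheme \<Rightarrow> 'b \<Rightarrow> 'n \<Rightarrow> ('b \<times> 'n \<Rightarrow>\<^sub>0 int) set" where
  "tensor_elem R M act N x p =
     tensor_null R M act N #>\<^bsub>free_Abelian_group (carrier M \<times> carrier N)\<^esub> frag_of (x, p)"


definition push :: "(imat, 'b, 'd) module_scheme \<Rightarrow> (nat \<rightharpoonup> nat) \<Rightarrow> 'b \<Rightarrow> 'b" where
  "push M f m = U f \<odot>\<^bsub>M\<^esub> m"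

definition right_act :: "(imat, 'b, 'd) module_scheme \<Rightarrow> 'b \<Rightarrow> imat \<Rightarrow> 'b" where
  "right_act M m A = mat_transp A \<odot>\<^bsub>M\<^esub> m"

definition H0 :: "(imat, 'b, 'd) module_scheme \<Rightarrow> ('b \<times> (nat \<Rightarrow> int) \<Rightarrow>\<^sub>0 int) set monoid" where
  "H0 M = tensor_product Gamma M (right_act M) P_mod"

definition H0_map ::
  "(imat, 'b, 'd) module_scheme \<Rightarrow> 'b \<Rightarrow> ('b \<times> (nat \<Rightarrow> int) \<Rightarrow>\<^sub>0 int) set" where
  "H0_map M m = tensor_elem Gamma M (right_act M) P_mod m \<one>\<^bsub>P_mod\<^esub>"

definition coinv_null :: "(imat, 'b, 'd) module_scheme \<Rightarrow> (nat \<rightharpoonup> nat) set \<Rightarrow> 'b set" where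
  "coinv_null M S =
     generate (add_monoid M) {m \<ominus>\<^bsub>M\<^esub> push M f m | m f. m \<in> carrier M \<and> f \<in> S}"

definition coinvariants :: "(imat, 'b, 'd) module_scheme \<Rightarrow> (nat \<rightharpoonup> nat) set \<Rightarrow> 'b set monoid" where
  "coinvariants M S = add_monoid M Mod coinv_null M S"

definition coinv_map :: "(imat, 'b, 'd) module_scheme \<Rightarrow> (nat \<rightharpoonup> nat) set \<Rightarrow> 'b \<Rightarrow> 'b set" where
  "coinv_map M S m = coinv_null M S #>\<^bsub>add_monoid M\<^esub> m"


subsection \<open>The definitions are well-formed\<close>

lemma pinv_eq_Some_iff:
  assumes "f \<in> Emb"
  shows "pinv f n = Some m \<longleftrightarrow> f m = Some n"
proof -
  have uniq: "(THE m. f m = Some n) = m" if "f m = Some n" for m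
    using that assms by (intro the_equality) (auto simp: Emb_def inj_on_def dom_def)
  show ?thesis
    using uniq by (auto simp: pinv_def ran_def)
qed

lemma mat_transp_U: "f \<in> Emb \<Longrightarrow> mat_transp (U f) = U (pinv f)"
  by (intro ext) (simp add: mat_transp_def U_def pinv_eq_Some_iff)

lemma right_act_U: "f \<in> Emb \<Longrightarrow> right_act M m (U f) = push M (pinv f) m"
  by (simp add: right_act_def push_def mat_transp_U)

lemma mat_transp_transp [simp]: "mat_transp (mat_transp A) = A"
  by (simp add: mat_transp_def)

lemma finite_entries_iff: "finite_entries A \<longleftrightarrow> (\<exists>c. \<forall>i j. \<bar>A i j\<bar> \<le> c)"
proof
  assume "finite_entries A"
  then have "finite (abs ` {A i j | i j. True})"
    by (simp add: finite_entries_def)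
  then show "\<exists>c. \<forall>i j. \<bar>A i j\<bar> \<le> c"
    by (intro exI[of _ "Max (abs ` {A i j | i j. True})"]) (auto intro!: Max_ge)
next
  assume "\<exists>c. \<forall>i j. \<bar>A i j\<bar> \<le> c"
  then obtain c where "\<forall>i j. \<bar>A i j\<bar> \<le> c" by blast
  then have "{A i j | i j. True} \<subseteq> {-c..c}"
    by (auto simp: abs_le_iff) (metis add.inverse_inverse neg_le_iff_le)
  then show "finite_entries A"
    unfolding finite_entries_def by (rule finite_subset) simp
qed

lemma finite_range_iff: "finite (range (p :: nat \<Rightarrow> int)) \<longleftrightarrow> (\<exists>c. \<forall>n. \<bar>p n\<bar> \<le> c)"
  using finite_entries_iff[of "\<lambda>i j. p j"] by (simp add: finite_entries_def full_SetCompr_eq)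

lemma mat_vec_eq:
  assumes "{j. A i j \<noteq> 0} \<subseteq> S" "finite S"
  shows "mat_vec A v i = (\<Sum>j\<in>S. A i j * v j)"
  unfolding mat_vec_def using assms by (intro Sum_any.expand_superset) auto

lemma mat_mult_as_vec: "mat_mult A B i k = mat_vec A (\<lambda>j. B j k) i"
  by (simp add: mat_mult_def mat_vec_def)

lemma mat_mult_col: "(\<lambda>i. mat_mult A B i k) = mat_vec A (\<lambda>j. B j k)"
  by (simp add: mat_mult_def mat_vec_def)

lemma mat_vec_row:
  assumes "bounded_rows A"
  shows "mat_vec A v i = (\<Sum>j\<in>{j. A i j \<noteq> 0}. A i j * v j)"
  using assms by (intro mat_vec_eq) (auto simp: bounded_rows_def)

lemma bounded_rows_finite: "bounded_rows A \<Longrightarrow> finite {j. A i j \<noteq> 0}"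
  by (auto simp: bounded_rows_def)

lemma mat_vec_bound:
  assumes "bounded_rows A" "finite_entries A" "\<forall>j. \<bar>v j\<bar> \<le> c"
  shows "\<exists>d. \<forall>v i. (\<forall>j. \<bar>v j\<bar> \<le> c) \<longrightarrow> \<bar>mat_vec A v i\<bar> \<le> d"
proof -
  obtain N where N: "\<And>i. finite {j. A i j \<noteq> 0}" "\<And>i. card {j. A i j \<noteq> 0} \<le> N"
    using assms by (auto simp: bounded_rows_def)
  obtain a where a: "\<And>i j. \<bar>A i j\<bar> \<le> a"
    using assms by (auto simp: finite_entries_iff)
  have a0: "0 \<le> a" using a[of 0 0] by linarith
  have c0: "0 \<le> c" using assms(3) by (meson abs_ge_zero order_trans)
  have "\<bar>mat_vec A w i\<bar> \<le> int N * (a * c)" if w: "\<forall>j. \<bar>w j\<bar> \<le> c" for w i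
  proof -
    have "\<bar>mat_vec A w i\<bar> \<le> (\<Sum>j\<in>{j. A i j \<noteq> 0}. \<bar>A i j * w j\<bar>)"
      using mat_vec_row[OF assms(1), of w i] by simp
    moreover have "\<dots> \<le> (\<Sum>j\<in>{j. A i j \<noteq> 0}. a * c)"
      using a w a0 by (intro sum_mono) (simp add: abs_mult mult_mono)
    moreover have "\<dots> \<le> int N * (a * c)"
      using N(2)[of i] a0 c0 by (simp add: mult_right_mono)
    ultimately show ?thesis by linarith
  qed
  then show ?thesis by blast
qed

lemma mat_vec_closed:
  assumes "bounded_rows A" "finite_entries A" "finite (range p)"
  shows "finite (range (mat_vec A p))"
  using assms mat_vec_bound[OF assms(1,2)] by (metis finite_range_iff)

lemma bounded_rows_mult:
  assumes "bounded_rows A" "bounded_rows B"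
  shows "bounded_rows (mat_mult A B)"
proof -
  obtain N where N: "\<And>i. finite {j. A i j \<noteq> 0}" "\<And>i. card {j. A i j \<noteq> 0} \<le> N"
    using assms by (auto simp: bounded_rows_def)
  obtain K where K: "\<And>i. finite {j. B i j \<noteq> 0}" "\<And>i. card {j. B i j \<noteq> 0} \<le> K"
    using assms by (auto simp: bounded_rows_def)
  have "finite {k. mat_mult A B i k \<noteq> 0} \<and> card {k. mat_mult A B i k \<noteq> 0} \<le> N * K" for i
  proof -
    let ?T = "\<Union>j\<in>{j. A i j \<noteq> 0}. {k. B j k \<noteq> 0}"
    have fin: "finite ?T" using N K by blast
    have sub: "{k. mat_mult A B i k \<noteq> 0} \<subseteq> ?T"
      unfolding mat_mult_def by (auto elim!: Sum_any.not_neutral_obtains_not_neutral)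
    have "card ?T \<le> (\<Sum>j\<in>{j. A i j \<noteq> 0}. card {k. B j k \<noteq> 0})"
      using N(1) by (rule card_UN_le)
    also have "\<dots> \<le> (\<Sum>j\<in>{j. A i j \<noteq> 0}. K)"
      using K(2) by (intro sum_mono)
    also have "\<dots> \<le> N * K"
      using N(2)[of i] by simp
    finally have "card ?T \<le> N * K" .
    then show ?thesis
      using fin sub by (meson card_mono finite_subset order_trans)
  qed
  then show ?thesis unfolding bounded_rows_def by blast
qed

lemma mat_transp_mult: "mat_transp (mat_mult A B) = mat_mult (mat_transp B) (mat_transp A)"
  by (simp add: mat_transp_def mat_mult_def mult.commute)

lemma mat_vec_mult:
  assumes "bounded_rows A" "bounded_rows B"
  shows "mat_vec (mat_mult A B) v = mat_vec A (mat_vec B v)"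
proof
  fix i
  let ?S = "{j. A i j \<noteq> 0}"
  let ?T = "\<Union>j\<in>?S. {k. B j k \<noteq> 0}"
  have S: "finite ?S" using assms by (simp add: bounded_rows_finite)
  have T: "finite ?T" using assms S by (auto simp: bounded_rows_finite)
  have AB: "mat_mult A B i k = (\<Sum>j\<in>?S. A i j * B j k)" for k
    by (simp add: mat_mult_as_vec mat_vec_row[OF assms(1)])
  have "{k. mat_mult A B i k \<noteq> 0} \<subseteq> ?T"
    unfolding mat_mult_def by (auto elim!: Sum_any.not_neutral_obtains_not_neutral)
  then have "mat_vec (mat_mult A B) v i = (\<Sum>k\<in>?T. (\<Sum>j\<in>?S. A i j * B j k) * v k)"
    using mat_vec_eq[OF _ T] AB by simp
  also have "\<dots> = (\<Sum>k\<in>?T. \<Sum>j\<in>?S. A i j * (B j k * v k))"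
    by (simp add: sum_distrib_right mult.assoc)
  also have "\<dots> = (\<Sum>j\<in>?S. \<Sum>k\<in>?T. A i j * (B j k * v k))"
    by (rule sum.swap)
  also have "\<dots> = (\<Sum>j\<in>?S. A i j * mat_vec B v j)"
  proof (intro sum.cong refl)
    fix j assume "j \<in> ?S"
    then have "mat_vec B v j = (\<Sum>k\<in>?T. B j k * v k)"
      by (intro mat_vec_eq T) blast
    then show "(\<Sum>k\<in>?T. A i j * (B j k * v k)) = A i j * mat_vec B v j"
      by (simp add: sum_distrib_left)
  qed
  also have "\<dots> = mat_vec A (mat_vec B v) i"
    using mat_vec_row[OF assms(1)] by simp
  finally show "mat_vec (mat_mult A B) v i = mat_vec A (mat_vec B v) i" .
qed

lemma mat_vec_add_right:
  assumes "bounded_rows A"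
  shows "mat_vec A (\<lambda>n. v n + w n) = (\<lambda>n. mat_vec A v n + mat_vec A w n)"
  using mat_vec_row[OF assms] by (simp add: fun_eq_iff distrib_left sum.distrib)

lemma mat_vec_add_left:
  assumes "bounded_rows A" "bounded_rows B"
  shows "mat_vec (\<lambda>i j. A i j + B i j) v = (\<lambda>n. mat_vec A v n + mat_vec B v n)"
proof
  fix i
  let ?S = "{j. A i j \<noteq> 0} \<union> {j. B i j \<noteq> 0}"
  have S: "finite ?S" using assms by (simp add: bounded_rows_finite)
  have "mat_vec (\<lambda>i j. A i j + B i j) v i = (\<Sum>j\<in>?S. (A i j + B i j) * v j)"
    by (rule mat_vec_eq[OF _ S]) auto
  moreover have "mat_vec A v i = (\<Sum>j\<in>?S. A i j * v j)" "mat_vec B v i = (\<Sum>j\<in>?S. B i j * v j)"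
    by (rule mat_vec_eq[OF _ S]; auto)+
  ultimately show "mat_vec (\<lambda>i j. A i j + B i j) v i = mat_vec A v i + mat_vec B v i"
    by (simp add: distrib_right sum.distrib)
qed

lemma mat_vec_diag: "mat_vec (diag p) v = (\<lambda>n. p n * v n)"
proof
  fix i
  have "mat_vec (diag p) v i = (\<Sum>j\<in>{i}. diag p i j * v j)"
    by (rule mat_vec_eq) (auto simp: diag_def)
  then show "mat_vec (diag p) v i = p i * v i" by (simp add: diag_def)
qed

lemma mat_vec_U:
  assumes "f \<in> Emb"
  shows "mat_vec (U f) p n = (case pinv f n of None \<Rightarrow> 0 | Some m \<Rightarrow> p m)"
proof (cases "pinv f n")
  case None
  then have "U f n j = 0" for j
    using pinv_eq_Some_iff[OF assms, of n j] by (auto simp: U_def)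
  then show ?thesis using None by (simp add: mat_vec_def)
next
  case (Some m)
  then have U: "U f n j = (if j = m then 1 else 0)" for j
    using pinv_eq_Some_iff[OF assms, of n j] by (auto simp: U_def)
  have "mat_vec (U f) p n = (\<Sum>j\<in>{m}. U f n j * p j)"
    by (rule mat_vec_eq) (auto simp: U)
  then show ?thesis using Some by (simp add: U)
qed

lemma bounded_rows_add:
  assumes "bounded_rows A" "bounded_rows B"
  shows "bounded_rows (\<lambda>i j. A i j + B i j)"
proof -
  obtain N where N: "\<And>i. finite {j. A i j \<noteq> 0}" "\<And>i. card {j. A i j \<noteq> 0} \<le> N"
    using assms by (auto simp: bounded_rows_def)
  obtain K where K: "\<And>i. finite {j. B i j \<noteq> 0}" "\<And>i. card {j. B i j \<noteq> 0} \<le> K"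
    using assms by (auto simp: bounded_rows_def)
  have "finite {j. A i j + B i j \<noteq> 0} \<and> card {j. A i j + B i j \<noteq> 0} \<le> N + K" for i
  proof -
    have sub: "{j. A i j + B i j \<noteq> 0} \<subseteq> {j. A i j \<noteq> 0} \<union> {j. B i j \<noteq> 0}" by auto
    have "card ({j. A i j \<noteq> 0} \<union> {j. B i j \<noteq> 0}) \<le> N + K"
      using card_Un_le N(2)[of i] K(2)[of i] by (meson add_mono order_trans)
    then show ?thesis
      using sub N(1) K(1) by (meson card_mono finite_UnI finite_subset order_trans)
  qed
  then show ?thesis unfolding bounded_rows_def by blast
qed

lemma bounded_rows_diag: "bounded_rows (diag p)"
proof -
  have "{j. diag p i j \<noteq> 0} \<subseteq> {i}" for i by (auto simp: diag_def)
  then have "finite {j. diag p i j \<noteq> 0} \<and> card {j. diag p i j \<noteq> 0} \<le> 1" for i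
    using card_mono[of "{i}"] finite_subset[of _ "{i}"] by fastforce
  then show ?thesis unfolding bounded_rows_def by blast
qed

lemma mat_transp_diag: "mat_transp (diag p) = diag p"
  by (auto simp: mat_transp_def diag_def fun_eq_iff)

lemma mat_transp_add: "mat_transp (\<lambda>i j. A i j + B i j) = (\<lambda>i j. mat_transp A i j + mat_transp B i j)"
  by (simp add: mat_transp_def)

lemma carrier_Gamma:
  "A \<in> carrier Gamma \<longleftrightarrow> finite_entries A \<and> bounded_rows A \<and> bounded_rows (mat_transp A)"
  by (simp add: Gamma_def)

lemma mat_transp_closed: "A \<in> carrier Gamma \<Longrightarrow> mat_transp A \<in> carrier Gamma"
  unfolding carrier_Gamma by (auto simp: finite_entries_iff mat_transp_def)

lemma diag_closed: "diag p \<in> carrier Gamma \<longleftrightarrow> p \<in> carrier P_mod"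
proof -
  have "finite_entries (diag p) \<longleftrightarrow> finite (range p)"
  proof
    assume "finite_entries (diag p)"
    then show "finite (range p)"
      by (metis diag_def finite_entries_iff finite_range_iff)
  next
    assume "finite (range p)"
    then obtain c where c: "\<forall>n. \<bar>p n\<bar> \<le> c" by (auto simp: finite_range_iff)
    then have "0 \<le> c" by (meson abs_ge_zero order_trans)
    with c show "finite_entries (diag p)"
      by (auto simp: finite_entries_iff diag_def)
  qed
  then show ?thesis
    by (simp add: carrier_Gamma bounded_rows_diag mat_transp_diag P_mod_def)
qed

lemma diag_image:
  "diag ` carrier P_mod = {A \<in> carrier Gamma. \<forall>i j. i \<noteq> j \<longrightarrow> A i j = 0}"
proof (intro equalityI subsetI)
  fix A assume A: "A \<in> {A \<in> carrier Gamma. \<forall>i j. i \<noteq> j \<longrightarrow> A i j = 0}"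
  then have "A = diag (\<lambda>i. A i i)" by (auto simp: diag_def fun_eq_iff)
  moreover from this A have "(\<lambda>i. A i i) \<in> carrier P_mod"
    by (metis (no_types, lifting) diag_closed mem_Collect_eq)
  ultimately show "A \<in> diag ` carrier P_mod" by blast
qed (auto simp: diag_closed, auto simp: diag_def)

lemma diag_mult: "mat_mult (diag p) (diag q) = diag (\<lambda>n. p n * q n)"
  by (simp add: fun_eq_iff mat_mult_as_vec mat_vec_diag) (simp add: diag_def)

lemma U_closed:
  assumes "f \<in> Emb"
  shows "U f \<in> carrier Gamma"
proof -
  have rows: "bounded_rows (U g)" if "g \<in> Emb" for g
  proof -
    have "finite {j. U g i j \<noteq> 0} \<and> card {j. U g i j \<noteq> 0} \<le> 1" for i
    proof (cases "pinv g i")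
      case None
      then have "{j. U g i j \<noteq> 0} = {}"
        using pinv_eq_Some_iff[OF that, of i] by (auto simp: U_def)
      then show ?thesis by simp
    next
      case (Some m)
      then have "{j. U g i j \<noteq> 0} = {m}"
        by (auto simp: U_def simp flip: pinv_eq_Some_iff[OF that])
      then show ?thesis by simp
    qed
    then show ?thesis unfolding bounded_rows_def by blast
  qed
  have "bounded_rows (mat_transp (U f))"
  proof -
    have "{i. mat_transp (U f) j i \<noteq> 0} \<subseteq> set_option (f j)" for j
      by (auto simp: mat_transp_def U_def split: if_splits)
    moreover have "finite (set_option (f j)) \<and> card (set_option (f j)) \<le> 1" for j
      by (cases "f j") auto
    ultimately have "finite {i. mat_transp (U f) j i \<noteq> 0} \<and> card {i. mat_transp (U f) j i \<noteq> 0} \<le> 1" for j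
      by (meson card_mono finite_subset order_trans)
    then show ?thesis unfolding bounded_rows_def by blast
  qed
  moreover have "finite_entries (U f)"
    unfolding finite_entries_iff by (intro exI[of _ 1]) (simp add: U_def)
  ultimately show ?thesis using rows[OF assms] by (simp add: carrier_Gamma)
qed

lemma finite_entries_mult:
  assumes "bounded_rows A" "finite_entries A" "finite_entries B"
  shows "finite_entries (mat_mult A B)"
proof -
  obtain c where c: "\<And>i j. \<bar>B i j\<bar> \<le> c"
    using assms by (auto simp: finite_entries_iff)
  obtain d where d: "\<forall>v i. (\<forall>j. \<bar>v j\<bar> \<le> c) \<longrightarrow> \<bar>mat_vec A v i\<bar> \<le> d"
    using mat_vec_bound[OF assms(1,2), of "\<lambda>j. B j 0" c] c by auto
  have "\<bar>mat_vec A (\<lambda>j. B j k) i\<bar> \<le> d" for i k using d c by simp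
  then show ?thesis
    unfolding finite_entries_iff mat_mult_as_vec by blast
qed

lemma finite_entries_add:
  assumes "finite_entries A" "finite_entries B"
  shows "finite_entries (\<lambda>i j. A i j + B i j)"
proof -
  obtain a b where "\<And>i j. \<bar>A i j\<bar> \<le> a" "\<And>i j. \<bar>B i j\<bar> \<le> b"
    using assms by (auto simp: finite_entries_iff)
  then have "\<bar>A i j + B i j\<bar> \<le> a + b" for i j by (meson abs_triangle_ineq add_mono order_trans)
  then show ?thesis unfolding finite_entries_iff by blast
qed

lemma uminus_closed: "A \<in> carrier Gamma \<Longrightarrow> (\<lambda>i j. - A i j) \<in> carrier Gamma"
  by (simp add: carrier_Gamma finite_entries_iff bounded_rows_def mat_transp_def)

lemma ring_Gamma: "ring Gamma"
proof (rule ringI)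
  show "abelian_group Gamma"
  proof (rule abelian_groupI)
    show "\<zero>\<^bsub>Gamma\<^esub> \<in> carrier Gamma"
      unfolding carrier_Gamma
      by (auto simp: Gamma_def finite_entries_iff bounded_rows_def mat_transp_def)
  next
    fix A B assume "A \<in> carrier Gamma" "B \<in> carrier Gamma"
    then show "A \<oplus>\<^bsub>Gamma\<^esub> B \<in> carrier Gamma"
      by (simp add: Gamma_def bounded_rows_add mat_transp_add finite_entries_add)
  next
    fix A assume "A \<in> carrier Gamma"
    then show "\<exists>B\<in>carrier Gamma. B \<oplus>\<^bsub>Gamma\<^esub> A = \<zero>\<^bsub>Gamma\<^esub>"
      using uminus_closed by (intro bexI[of _ "\<lambda>i j. - A i j"]) (auto simp: Gamma_def)
  qed (simp_all add: Gamma_def add_ac)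
  show "monoid Gamma"
  proof (rule monoidI)
    fix A B assume "A \<in> carrier Gamma" "B \<in> carrier Gamma"
    then show "A \<otimes>\<^bsub>Gamma\<^esub> B \<in> carrier Gamma"
      by (simp add: Gamma_def bounded_rows_mult finite_entries_mult mat_transp_mult)
  next
    have "\<one>\<^bsub>Gamma\<^esub> = diag (\<lambda>n. 1)" by (simp add: Gamma_def diag_def fun_eq_iff)
    then show "\<one>\<^bsub>Gamma\<^esub> \<in> carrier Gamma" by (simp add: diag_closed P_mod_def)
  next
    fix A B C assume "A \<in> carrier Gamma" "B \<in> carrier Gamma" "C \<in> carrier Gamma"
    then show "A \<otimes>\<^bsub>Gamma\<^esub> B \<otimes>\<^bsub>Gamma\<^esub> C = A \<otimes>\<^bsub>Gamma\<^esub> (B \<otimes>\<^bsub>Gamma\<^esub> C)"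
      by (simp add: Gamma_def fun_eq_iff mat_mult_as_vec[of _ C] mat_mult_as_vec[of A "mat_mult B C"]
          mat_vec_mult mat_mult_col)
  next
    fix A assume "A \<in> carrier Gamma"
    have I: "\<one>\<^bsub>Gamma\<^esub> = diag (\<lambda>n. 1)" by (simp add: Gamma_def diag_def fun_eq_iff)
    have L: "mat_mult (diag (\<lambda>n. 1)) B = B" for B
      by (simp add: fun_eq_iff mat_mult_as_vec mat_vec_diag)
    have "mat_transp (mat_mult A (diag (\<lambda>n. 1))) = mat_transp A"
      by (simp add: mat_transp_mult mat_transp_diag L)
    then have "mat_mult A (diag (\<lambda>n. 1)) = A"
      by (metis mat_transp_transp)
    then show "A \<otimes>\<^bsub>Gamma\<^esub> \<one>\<^bsub>Gamma\<^esub> = A" unfolding I by (simp add: Gamma_def)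
    show "\<one>\<^bsub>Gamma\<^esub> \<otimes>\<^bsub>Gamma\<^esub> A = A" unfolding I using L by (simp add: Gamma_def)
  qed
next
  fix A B C assume *: "A \<in> carrier Gamma" "B \<in> carrier Gamma" "C \<in> carrier Gamma"
  then show "(A \<oplus>\<^bsub>Gamma\<^esub> B) \<otimes>\<^bsub>Gamma\<^esub> C = A \<otimes>\<^bsub>Gamma\<^esub> C \<oplus>\<^bsub>Gamma\<^esub> B \<otimes>\<^bsub>Gamma\<^esub> C"
    by (simp add: Gamma_def fun_eq_iff mat_mult_as_vec mat_vec_add_left)
  show "C \<otimes>\<^bsub>Gamma\<^esub> (A \<oplus>\<^bsub>Gamma\<^esub> B) = C \<otimes>\<^bsub>Gamma\<^esub> A \<oplus>\<^bsub>Gamma\<^esub> C \<otimes>\<^bsub>Gamma\<^esub> B"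
    using * by (simp add: Gamma_def fun_eq_iff mat_mult_as_vec mat_vec_add_right)
qed

lemma abelian_group_P_mod: "abelian_group P_mod"
proof (rule abelian_groupI)
  fix p q assume "p \<in> carrier P_mod" "q \<in> carrier P_mod"
  then obtain a b where "\<And>n. \<bar>p n\<bar> \<le> a" "\<And>n. \<bar>q n\<bar> \<le> b"
    by (auto simp: P_mod_def finite_range_iff)
  then have "\<bar>p n + q n\<bar> \<le> a + b" for n by (meson abs_triangle_ineq add_mono order_trans)
  then show "p \<oplus>\<^bsub>P_mod\<^esub> q \<in> carrier P_mod"
    by (auto simp: P_mod_def finite_range_iff)
next
  fix p assume "p \<in> carrier P_mod"
  then show "\<exists>q\<in>carrier P_mod. q \<oplus>\<^bsub>P_mod\<^esub> p = \<zero>\<^bsub>P_mod\<^esub>"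
    by (intro bexI[of _ "\<lambda>n. - p n"]) (auto simp: P_mod_def finite_range_iff)
qed (simp_all add: P_mod_def add_ac)

lemma left_module_P_mod: "left_module Gamma P_mod"
proof (intro left_module.intro left_module_axioms.intro ring_Gamma abelian_group_P_mod)
  fix p assume "p \<in> carrier P_mod"
  have "\<one>\<^bsub>Gamma\<^esub> = diag (\<lambda>n. 1)" by (simp add: Gamma_def diag_def fun_eq_iff)
  then show "\<one>\<^bsub>Gamma\<^esub> \<odot>\<^bsub>P_mod\<^esub> p = p" by (simp add: P_mod_def mat_vec_diag)
qed (simp_all add: carrier_Gamma P_mod_def Gamma_def mat_vec_closed mat_vec_add_left
      mat_vec_add_right mat_vec_mult)

lemma right_act_mult:
  assumes "left_module Gamma M" "m \<in> carrier M" "A \<in> carrier Gamma" "B \<in> carrier Gamma"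
  shows "right_act M m (A \<otimes>\<^bsub>Gamma\<^esub> B) = right_act M (right_act M m A) B"
proof -
  have "mat_transp (A \<otimes>\<^bsub>Gamma\<^esub> B) = mat_transp B \<otimes>\<^bsub>Gamma\<^esub> mat_transp A"
    by (simp add: Gamma_def mat_transp_mult)
  then show ?thesis
    using left_module.smult_assoc1[OF assms(1)] assms(2-4)
    by (simp add: right_act_def mat_transp_closed)
qed

end

theory Submission
  imports Defs
begin

text \<open>
  The module \<open>\<P>\<close> is generated by the constant sequence 1, so \<open>m \<otimes> p = (diag p \<cdot> m) \<otimes> 1\<close>. The kernels
  coincide because in \<open>M\<close> modulo the relations of \<open>\<E>\<^sup>*\<close> every \<open>A \<in> \<Gamma>\<close> acts as the diagonal matrix of
  its column sums. This is clear for \<open>A = U g \<cdot> diag p\<close> with \<open>g\<close> a bijection, and every \<open>A\<close> is a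
  finite sum of such matrices: a monomial matrix with infinitely many zero rows and infinitely many
  zero columns has this form. It follows that \<open>m \<otimes> p \<mapsto> [diag p \<cdot> m]\<close> is well defined on the tensor
  product, and it is a left inverse of \<open>[m] \<mapsto> m \<otimes> 1\<close>.
\<close>

section \<open>Quotients of abelian groups and tensor products\<close>

lemma (in comm_group) rcoset_epi:
  assumes "subgroup N G"
  shows "(\<lambda>x. N #> x) \<in> epi G (G Mod N)"
  using assms normal.r_coset_hom_Mod[OF subgroup_imp_normal[OF assms]]
  by (auto simp: epi_def FactGroup_def RCOSETS_def)

lemma (in comm_group) kernel_rcoset:
  assumes "subgroup N G"
  shows "kernel G (G Mod N) (\<lambda>x. N #> x) = N"
  using subgroup.mem_carrier[OF assms] coset_join1[OF _ _ assms] coset_join2[OF _ assms]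
  by (auto simp: kernel_def FactGroup_def)

lemma (in comm_group) rcoset_cong:
  assumes "subgroup N G" "x \<in> carrier G" "y \<in> carrier G" "x \<otimes> inv y \<in> N"
  shows "N #> x = N #> y"
  using assms by (metis inv_closed is_group m_comm repr_independence subgroup.rcos_module_rev)

text \<open>The tensor product is given by generators and relations. Closure of \<open>act\<close>
  places the balancing relations inside the free abelian group \<open>F\<close>.\<close>

locale tensor_setup =
  fixes R :: "('a, 'c) ring_scheme" and M :: "('b, 'd) ring_scheme"
    and act :: "'b \<Rightarrow> 'a \<Rightarrow> 'b" and N :: "('a, 'n, 'e) module_scheme"
  assumes M: "abelian_group M" and N: "left_module R N"
    and act_closed: "\<lbrakk>x \<in> carrier M; a \<in> carrier R\<rbrakk> \<Longrightarrow> act x a \<in> carrier M"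
begin

interpretation M: abelian_group M by (rule M)
interpretation N: left_module R N by (rule N)

abbreviation "F \<equiv> free_Abelian_group (carrier M \<times> carrier N)"
abbreviation "T \<equiv> tensor_null R M act N"
abbreviation "Q \<equiv> tensor_product R M act N"
abbreviation tens (infixl \<open>\<star>\<close> 70) where "x \<star> p \<equiv> tensor_elem R M act N x p"

interpretation F: comm_group F by (rule abelian_free_Abelian_group)

lemma tensor_relations_closed: "tensor_relations R M act N \<subseteq> carrier F"
proof -
  have diff: "u - v \<in> carrier F" if "u \<in> carrier F" "v \<in> carrier F" for u v
    using that keys_diff[of u v] unfolding carrier_free_Abelian_group_iff by blast
  show ?thesis
    unfolding tensor_relations_def
    by (intro Un_least subsetI; elim CollectE exE conjE; hypsubst; intro diff)
       (simp_all add: act_closed)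
qed

lemma subgroup_tensor_null: "subgroup T F"
  unfolding tensor_null_def by (rule F.generate_is_subgroup[OF tensor_relations_closed])

lemma comm_group_tensor_product: "comm_group Q"
  unfolding tensor_product_def by (rule F.abelian_FactGroup[OF subgroup_tensor_null])

lemma tensor_coset_hom: "(\<lambda>u. T #>\<^bsub>F\<^esub> u) \<in> hom F Q"
  using F.rcoset_epi[OF subgroup_tensor_null] by (simp add: epi_def tensor_product_def)

lemma tensor_coset_cong:
  assumes "u - v \<in> tensor_relations R M act N" "u \<in> carrier F" "v \<in> carrier F"
  shows "T #>\<^bsub>F\<^esub> u = T #>\<^bsub>F\<^esub> v"
proof (rule F.rcoset_cong[OF subgroup_tensor_null assms(2,3)])
  show "u \<otimes>\<^bsub>F\<^esub> inv\<^bsub>F\<^esub> v \<in> T"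
    using assms generate.incl[of "u - v" "tensor_relations R M act N" F]
    by (simp add: tensor_null_def)
qed

lemma tensor_elem_closed:
  "\<lbrakk>x \<in> carrier M; p \<in> carrier N\<rbrakk> \<Longrightarrow> x \<star> p \<in> carrier Q"
  using tensor_coset_hom by (simp add: tensor_elem_def hom_def Pi_iff)

lemma tensor_elem_add_left:
  assumes "x \<in> carrier M" "y \<in> carrier M" "p \<in> carrier N"
  shows "(x \<oplus>\<^bsub>M\<^esub> y) \<star> p = (x \<star> p) \<otimes>\<^bsub>Q\<^esub> (y \<star> p)"
proof -
  have "(x \<star> p) \<otimes>\<^bsub>Q\<^esub> (y \<star> p) = T #>\<^bsub>F\<^esub> (frag_of (x, p) + frag_of (y, p))"
    using hom_mult[OF tensor_coset_hom, of "frag_of (x, p)" "frag_of (y, p)"] assms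
    by (simp add: tensor_elem_def)
  also have "\<dots> = (x \<oplus>\<^bsub>M\<^esub> y) \<star> p"
    unfolding tensor_elem_def
  proof (rule tensor_coset_cong[symmetric])
    show "frag_of (x \<oplus>\<^bsub>M\<^esub> y, p) - (frag_of (x, p) + frag_of (y, p))
        \<in> tensor_relations R M act N"
      using assms unfolding tensor_relations_def diff_diff_eq[symmetric] by blast
    have "Poly_Mapping.keys (frag_of (x, p) + frag_of (y, p)) \<subseteq> {(x, p), (y, p)}"
      by (rule order_trans[OF keys_add]) auto
    then show "frag_of (x, p) + frag_of (y, p) \<in> carrier F"
      using assms by auto
  qed (use assms in simp)
  finally show ?thesis by simp
qed

lemma tensor_elem_balanced:
  assumes "x \<in> carrier M" "a \<in> carrier R" "p \<in> carrier N"
  shows "act x a \<star> p = x \<star> (a \<odot>\<^bsub>N\<^esub> p)"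
  unfolding tensor_elem_def
proof (rule tensor_coset_cong)
  show "frag_of (act x a, p) - frag_of (x, a \<odot>\<^bsub>N\<^esub> p) \<in> tensor_relations R M act N"
    using assms unfolding tensor_relations_def by blast
qed (use assms act_closed in simp_all)

text \<open>The coset map from \<open>F\<close> is onto, and \<open>F\<close> is built from its
  basis by differences, so induction over \<open>F\<close> reduces membership in \<open>S\<close> to
  pure tensors. This serves to prove that \<open>H0_map\<close> is onto.\<close>

lemma tensor_product_generated:
  assumes "subgroup S Q" "\<And>x p. \<lbrakk>x \<in> carrier M; p \<in> carrier N\<rbrakk> \<Longrightarrow> x \<star> p \<in> S"
  shows "carrier Q \<subseteq> S"
proof
  fix w assume "w \<in> carrier Q"
  define h where "h u = T #>\<^bsub>F\<^esub> u" for u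
  have "h ` carrier F = carrier Q"
    using F.rcoset_epi[OF subgroup_tensor_null]
    unfolding epi_def tensor_product_def h_def[abs_def] by blast
  then obtain u where u: "u \<in> carrier F" "w = h u"
    using \<open>w \<in> carrier Q\<close> by blast
  have "group_hom F Q h"
    using tensor_coset_hom comm_group_tensor_product
    by (simp add: group_hom_def group_hom_axioms_def comm_group_def h_def[abs_def])
  then interpret h: group_hom F Q h .
  have "h u \<in> S"
    using u(1)[unfolded carrier_free_Abelian_group_iff]
  proof (induction u rule: free_Abelian_group_induct[consumes 1])
    case 1
    then show ?case
      using h.hom_one subgroup.one_closed[OF assms(1)] by simp
  next
    case (2 u v)
    have "h (u - v) = h u \<otimes>\<^bsub>Q\<^esub> inv\<^bsub>Q\<^esub> h v"
      using 2 h.hom_mult[of u "- v"] h.hom_inv[of v] by (simp add: keys_minus)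
    then show ?case
      using 2 assms(1) by (simp add: subgroup.m_closed subgroup.m_inv_closed)
  next
    case (3 z)
    then show ?case using assms(2) by (auto simp: tensor_elem_def h_def)
  qed
  then show "w \<in> S" using u by simp
qed

text \<open>The universal property in the form needed for kernels: a biadditive balanced map extends
  to a homomorphism on \<open>F\<close> that kills the relations, hence all of \<open>T\<close>. A
  pure tensor that vanishes has its generator in \<open>T\<close>.\<close>

lemma tensor_elem_eq_one:
  assumes G: "comm_group G"
    and closed: "\<And>x p. \<lbrakk>x \<in> carrier M; p \<in> carrier N\<rbrakk> \<Longrightarrow> \<phi> x p \<in> carrier G"
    and left: "\<And>x y p. \<lbrakk>x \<in> carrier M; y \<in> carrier M; p \<in> carrier N\<rbrakk> \<Longrightarrow>
                 \<phi> (x \<oplus>\<^bsub>M\<^esub> y) p = \<phi> x p \<otimes>\<^bsub>G\<^esub> \<phi> y p"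
    and right: "\<And>x p q. \<lbrakk>x \<in> carrier M; p \<in> carrier N; q \<in> carrier N\<rbrakk> \<Longrightarrow>
                 \<phi> x (p \<oplus>\<^bsub>N\<^esub> q) = \<phi> x p \<otimes>\<^bsub>G\<^esub> \<phi> x q"
    and bal: "\<And>x a p. \<lbrakk>x \<in> carrier M; a \<in> carrier R; p \<in> carrier N\<rbrakk> \<Longrightarrow>
                 \<phi> (act x a) p = \<phi> x (a \<odot>\<^bsub>N\<^esub> p)"
    and xp: "x \<in> carrier M" "p \<in> carrier N" "x \<star> p = \<one>\<^bsub>Q\<^esub>"
  shows "\<phi> x p = \<one>\<^bsub>G\<^esub>"
proof -
  interpret G: comm_group G by (rule G)
  obtain h where hom: "h \<in> hom F G"
    and h: "\<And>z. z \<in> carrier M \<times> carrier N \<Longrightarrow> h (frag_of z) = (\<lambda>(x, p). \<phi> x p) z"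
    using G.free_Abelian_group_universal[of "\<lambda>(x, p). \<phi> x p" "carrier M \<times> carrier N"] closed
    by (auto simp: image_subset_iff)
  interpret h: group_hom F G h by unfold_locales (rule hom)
  have diff: "h (u - v) = h u \<otimes>\<^bsub>G\<^esub> inv\<^bsub>G\<^esub> h v" if "u \<in> carrier F" "v \<in> carrier F" for u v
    using that h.hom_mult[of u "- v"] h.hom_inv[of v] by (simp add: keys_minus)
  \<comment> \<open>Both additivity relations have the shape \<open>z - z1 - z2\<close>, so one
    computation covers them.\<close>
  have diff2: "h (frag_of z - frag_of z1 - frag_of z2) = \<one>\<^bsub>G\<^esub>"
    if "z \<in> carrier M \<times> carrier N" "z1 \<in> carrier M \<times> carrier N" "z2 \<in> carrier M \<times> carrier N"
      "h (frag_of z) = h (frag_of z1) \<otimes>\<^bsub>G\<^esub> h (frag_of z2)" for z z1 z2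
  proof -
    have c: "h (frag_of z1) \<in> carrier G" "h (frag_of z2) \<in> carrier G"
      using that by (intro h.hom_closed; simp)+
    have "frag_of z - frag_of z1 \<in> carrier F"
      using that keys_diff[of "frag_of z" "frag_of z1"] by auto
    then have "h (frag_of z - frag_of z1 - frag_of z2)
      = h (frag_of z1) \<otimes>\<^bsub>G\<^esub> h (frag_of z2) \<otimes>\<^bsub>G\<^esub> inv\<^bsub>G\<^esub> h (frag_of z1) \<otimes>\<^bsub>G\<^esub> inv\<^bsub>G\<^esub> h (frag_of z2)"
      using that by (simp add: diff)
    also have "\<dots> = h (frag_of z1) \<otimes>\<^bsub>G\<^esub> h (frag_of z2) \<otimes>\<^bsub>G\<^esub> inv\<^bsub>G\<^esub> (h (frag_of z1) \<otimes>\<^bsub>G\<^esub> h (frag_of z2))"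
      using c by (simp add: G.m_assoc G.inv_mult)
    also have "\<dots> = \<one>\<^bsub>G\<^esub>" using c by (intro G.r_inv G.m_closed)
    finally show ?thesis .
  qed
  have "tensor_relations R M act N \<subseteq> kernel F G h"
  proof
    fix u assume u: "u \<in> tensor_relations R M act N"
    have "h u = \<one>\<^bsub>G\<^esub>"
      using u unfolding tensor_relations_def
    proof (elim UnE CollectE exE conjE)
      fix x a p
      assume *: "u = frag_of (act x a, p) - frag_of (x, a \<odot>\<^bsub>N\<^esub> p)"
        "x \<in> carrier M" "a \<in> carrier R" "p \<in> carrier N"
      then have "\<phi> x (a \<odot>\<^bsub>N\<^esub> p) \<in> carrier G" by (simp add: closed)
      then show "h u = \<one>\<^bsub>G\<^esub>" using * by (simp add: diff h bal act_closed)
    qed (simp_all add: diff2 h left right)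
    then show "u \<in> kernel F G h"
      using u tensor_relations_closed unfolding kernel_def by blast
  qed
  then have "T \<subseteq> kernel F G h"
    unfolding tensor_null_def by (rule F.generate_subgroup_incl[OF _ h.subgroup_kernel])
  \<comment> \<open>The unit of the quotient is the coset \<open>T\<close> itself, so the hypothesis
    says that the coset of this generator is \<open>T\<close>.\<close>
  moreover have "frag_of (x, p) \<in> T"
    using xp F.coset_join1[OF _ _ subgroup_tensor_null, of "frag_of (x, p)"]
    by (simp add: tensor_elem_def tensor_product_def FactGroup_def)
  ultimately show ?thesis using h[of "(x, p)"] xp by (auto simp: kernel_def)
qed

end


section \<open>Splitting a matrix into monomial parts\<close>

text \<open>The complements of the domain and of the range are both countably infinite, so a
  bijection between them can be glued to \<open>f\<close>.\<close>

lemma extend_to_bijection: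
  assumes "f \<in> Emb" "infinite (- dom f)" "infinite (- ran f)"
  obtains g where "g \<in> Emb_bij" "f \<subseteq>\<^sub>m g"
proof -
  \<comment> \<open>Enumerate one complement by the naturals, then read off the enumeration of the
    other.\<close>
  have "bij_betw (from_nat_into (- ran f) \<circ> to_nat_on (- dom f)) (- dom f) (- ran f)"
    using assms by (intro bij_betw_trans[OF to_nat_on_infinite bij_betw_from_nat_into]) auto
  then obtain h where h: "bij_betw h (- dom f) (- ran f)" by blast
  have h_ran: "h j \<notin> ran f" if "f j = None" for j
    using bij_betwE[OF h] that by (auto simp: dom_def)
  have h_inj: "j = k" if "f j = None" "f k = None" "h j = h k" for j k
    using bij_betw_imp_inj_on[OF h] that by (auto simp: inj_on_def dom_def)
  have f_inj: "j = k" if "f j = Some i" "f k = Some i" for i j k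
    using assms(1) that by (auto simp: Emb_def inj_on_def dom_def)
  define g where "g j = (case f j of None \<Rightarrow> Some (h j) | Some i \<Rightarrow> Some i)" for j
  have inj: "j = k" if "g j = g k" for j k
    using that h_ran[of j] h_ran[of k] h_inj[of j k] f_inj[of j _ k]
    by (auto simp: g_def ranI split: option.splits)
  have "i \<in> ran g" for i
  proof (cases "i \<in> ran f")
    case True
    then obtain j where "f j = Some i" by (auto simp: ran_def)
    then show ?thesis by (intro ranI[of _ j]) (simp add: g_def)
  next
    case False
    then have "i \<in> h ` (- dom f)"
      using bij_betw_imp_surj_on[OF h] by simp
    then obtain j where "j \<notin> dom f" "h j = i" by auto
    then show ?thesis by (intro ranI[of _ j]) (auto simp: g_def dom_def)
  qed
  moreover have "dom g = UNIV" by (auto simp: g_def dom_def split: option.splits)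
  ultimately have "g \<in> Emb_bij"
    using inj by (auto simp: Emb_bij_def Emb_total_def Emb_def inj_on_def)
  moreover have "f \<subseteq>\<^sub>m g" by (auto simp: map_le_def g_def)
  ultimately show ?thesis by (rule that)
qed

text \<open>As the transpose applied to the constant sequence 1, this is what the tensor product
  retains of \<open>A\<close>: balancing gives (A m) tensor 1 = m tensor (A^T 1). Closure and
  additivity are then inherited from \<open>mat_vec\<close>.\<close>

definition column_sums :: "imat \<Rightarrow> nat \<Rightarrow> int" where
  "column_sums A = mat_vec (mat_transp A) (\<lambda>n. 1)"

lemma column_sums_closed: "A \<in> carrier Gamma \<Longrightarrow> column_sums A \<in> carrier P_mod"
  using mat_vec_closed[of "mat_transp A" "\<lambda>n. 1"] mat_transp_closed[of A]
  by (simp add: column_sums_def carrier_Gamma P_mod_def)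

lemma column_sums_add:
  "\<lbrakk>A \<in> carrier Gamma; B \<in> carrier Gamma\<rbrakk> \<Longrightarrow>
    column_sums (\<lambda>i j. A i j + B i j) = (\<lambda>n. column_sums A n + column_sums B n)"
  by (simp add: column_sums_def mat_transp_add mat_vec_add_left carrier_Gamma)

lemma mat_mult_diag_right: "mat_mult A (diag p) i j = A i j * p j"
proof -
  have "mat_mult A (diag p) i j = (\<Sum>k\<in>{j}. A i k * diag p k j)"
    unfolding mat_mult_def by (rule Sum_any.expand_superset) (auto simp: diag_def)
  then show ?thesis by (simp add: diag_def)
qed

text \<open>The nonzero pattern of \<open>B\<close> is the graph of a partial injection, and the
  infinitely many empty rows and columns let it extend to a bijection. The diagonal factor carries
  the one nonzero entry of each column.\<close>

lemma monomial_factorization: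
  assumes row: "\<And>i j k. \<lbrakk>B i j \<noteq> 0; B i k \<noteq> 0\<rbrakk> \<Longrightarrow> j = k"
    and col: "\<And>i j k. \<lbrakk>B i k \<noteq> 0; B j k \<noteq> 0\<rbrakk> \<Longrightarrow> i = j"
    and inf: "infinite {i. \<forall>j. B i j = 0}" "infinite {j. \<forall>i. B i j = 0}"
  obtains g where "g \<in> Emb_bij" "B = mat_mult (U g) (diag (column_sums B))"
proof -
  define f where "f j = (if \<exists>i. B i j \<noteq> 0 then Some (THE i. B i j \<noteq> 0) else None)" for j
  have f: "f j = Some i \<longleftrightarrow> B i j \<noteq> 0" for i j
  proof -
    have "(THE i. B i j \<noteq> 0) = i" if "B i j \<noteq> 0" for i
      using that col by blast
    then show ?thesis by (auto simp: f_def)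
  qed
  have "j = k" if "f j = Some i" "f k = Some i" for i j k
    using that row by (simp add: f)
  then have "f \<in> Emb" by (auto simp: Emb_def inj_on_def dom_def)
  moreover have "- dom f = {j. \<forall>i. B i j = 0}"
    by (auto simp: dom_def f)
  moreover have "- ran f = {i. \<forall>j. B i j = 0}" by (auto simp: ran_def f)
  ultimately obtain g where g: "g \<in> Emb_bij" "f \<subseteq>\<^sub>m g"
    using extend_to_bijection inf by metis
  have g_eq: "g j = Some i" if "B i j \<noteq> 0" for i j
    using g(2) f[of j i] that by (force simp: map_le_def dom_def)
  \<comment> \<open>Row \<open>the (g j)\<close> is the only place where column \<open>j\<close> can
    be nonzero. On an empty column both sides are 0, so the values chosen for \<open>g\<close>
    outside the domain of \<open>f\<close> do no harm.\<close>
  have "column_sums B j = B (the (g j)) j" for j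
  proof -
    have "column_sums B j = (\<Sum>i\<in>{the (g j)}. mat_transp B j i * 1)"
      unfolding column_sums_def by (rule mat_vec_eq) (auto simp: mat_transp_def dest: g_eq)
    then show ?thesis by (simp add: mat_transp_def)
  qed
  then have "B i j = mat_mult (U g) (diag (column_sums B)) i j" for i j
    using g_eq[of i j] by (auto simp: mat_mult_diag_right U_def)
  then show ?thesis using that g(1) by blast
qed

lemma bounded_rows_mono:
  assumes "bounded_rows A" "\<And>i j. A i j = 0 \<Longrightarrow> B i j = 0"
  shows "bounded_rows B"
proof -
  obtain K where K: "\<And>i. finite {j. A i j \<noteq> 0}" "\<And>i. card {j. A i j \<noteq> 0} \<le> K"
    using assms(1) by (auto simp: bounded_rows_def)
  have sub: "{j. B i j \<noteq> 0} \<subseteq> {j. A i j \<noteq> 0}" for i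
    using assms(2) by blast
  have "finite {j. B i j \<noteq> 0}" "card {j. B i j \<noteq> 0} \<le> K" for i
    using finite_subset[OF sub K(1)] order_trans[OF card_mono[OF K(1) sub] K(2)] by auto
  then show ?thesis unfolding bounded_rows_def by blast
qed

text \<open>This keeps the pieces in \<open>Gamma\<close> when a matrix is cut along colour
  classes.\<close>

lemma Gamma_restrict:
  assumes A: "A \<in> carrier Gamma" and B: "\<And>i j. B i j = A i j \<or> B i j = 0"
  shows "B \<in> carrier Gamma"
proof -
  have zero: "B i j = 0" if "A i j = 0" for i j
    using B[of i j] that by simp
  obtain c where c: "\<And>i j. \<bar>A i j\<bar> \<le> c"
    using A by (auto simp: carrier_Gamma finite_entries_iff)
  have "\<bar>B i j\<bar> \<le> c" for i j
    using B[of i j] c[of i j] by auto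
  then have "finite_entries B"
    unfolding finite_entries_iff by blast
  moreover have "bounded_rows B"
    using A by (intro bounded_rows_mono[of A B] zero) (simp add: carrier_Gamma)
  moreover have "bounded_rows (mat_transp B)"
    using A zero
    by (intro bounded_rows_mono[of "mat_transp A" "mat_transp B"])
       (simp_all add: carrier_Gamma mat_transp_def)
  ultimately show ?thesis by (simp add: carrier_Gamma)
qed

lemma infinite_residue_ne: "infinite {n::nat. n mod 2 \<noteq> a}"
proof -
  \<comment> \<open>The witnesses are the odd numbers for \<open>a = 0\<close> and the even numbers
    for every other \<open>a\<close>.\<close>
  have "{n. n mod 2 \<noteq> a} \<supseteq> range (\<lambda>n. 2 * n + (if a = 0 then 1 else 0))" by auto
  moreover have "infinite (range (\<lambda>n::nat. 2 * n + (if a = 0 then 1 else 0)))"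
    by (rule range_inj_infinite) (simp add: inj_def)
  ultimately show ?thesis using infinite_super by blast
qed

text \<open>If \<open>a < b\<close> and \<open>a\<close> lies in \<open>S\<close>, then
  \<open>a\<close> itself is counted below \<open>b\<close> but not below \<open>a\<close>, so rank
  is strictly increasing on \<open>S\<close>.\<close>

lemma rank_inj:
  fixes S :: "nat set"
  assumes "finite S" "j \<in> S" "k \<in> S" "card {l \<in> S. l < j} = card {l \<in> S. l < k}"
  shows "j = k"
proof -
  have "card {l \<in> S. l < a} < card {l \<in> S. l < b}" if "a < b" "a \<in> S" for a b
    using that assms(1) by (intro psubset_card_mono) auto
  from this[of j k] this[of k j] show ?thesis
    using assms(2-4) by (cases j k rule: linorder_cases) auto
qed

text \<open>
  Colour the entry \<open>(i, j)\<close> by its rank in its row, its rank in its column, and the parities of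
  \<open>i\<close> and \<open>j\<close>. The ranks separate entries in a common row or column; the parities leave
  infinitely many rows and columns of each colour class empty.
\<close>

lemma monomial_colouring:
  assumes A: "A \<in> carrier Gamma"
  obtains c :: "nat \<Rightarrow> nat \<Rightarrow> nat \<times> nat \<times> nat \<times> nat"
  where "finite {c i j | i j. A i j \<noteq> 0}"
    "\<And>i j k. \<lbrakk>A i j \<noteq> 0; A i k \<noteq> 0; c i j = c i k\<rbrakk> \<Longrightarrow> j = k"
    "\<And>i j k. \<lbrakk>A i k \<noteq> 0; A j k \<noteq> 0; c i k = c j k\<rbrakk> \<Longrightarrow> i = j"
    "\<And>x. infinite {i. \<forall>j. c i j \<noteq> x}" "\<And>x. infinite {j. \<forall>i. c i j \<noteq> x}"
proof -
  define r where "r B i j = card {l \<in> {k. B i k \<noteq> 0}. l < j}" for B :: imat and i j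
  have bounded: "\<exists>K. \<forall>i j. r B i j \<le> K" if B: "bounded_rows B" for B
  proof -
    obtain K where "\<And>i. card {j. B i j \<noteq> 0} \<le> K"
      using B by (auto simp: bounded_rows_def)
    moreover have "r B i j \<le> card {k. B i k \<noteq> 0}" for i j
      unfolding r_def using B by (intro card_mono) (auto simp: bounded_rows_finite)
    ultimately have "r B i j \<le> K" for i j
      using order_trans by blast
    then show ?thesis by blast
  qed
  have inj: "j = k" if "bounded_rows B" "B i j \<noteq> 0" "B i k \<noteq> 0" "r B i j = r B i k" for B i j k
    using rank_inj[of "{k. B i k \<noteq> 0}" j k] that bounded_rows_finite by (auto simp: r_def)
  obtain K where K: "\<And>i j. r A i j \<le> K"
    using bounded[of A] A by (auto simp: carrier_Gamma)
  obtain L where L: "\<And>i j. r (mat_transp A) i j \<le> L"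
    using bounded[of "mat_transp A"] A by (auto simp: carrier_Gamma)
  \<comment> \<open>The rank in a column is a rank in a row of the transpose, hence the swapped
    indices in the second component.\<close>
  define c where "c i j = (r A i j, r (mat_transp A) j i, i mod 2, j mod 2)" for i j
  have "{c i j | i j. A i j \<noteq> 0} \<subseteq> {..K} \<times> {..L} \<times> {..<2} \<times> {..<2}"
    using K L by (auto simp: c_def)
  then have "finite {c i j | i j. A i j \<noteq> 0}" by (rule finite_subset) simp
  moreover have "j = k" if "A i j \<noteq> 0" "A i k \<noteq> 0" "c i j = c i k" for i j k
    using inj[of A i j k] that A by (simp add: c_def carrier_Gamma)
  moreover have "i = j" if "A i k \<noteq> 0" "A j k \<noteq> 0" "c i k = c j k" for i j k
    using inj[of "mat_transp A" k i j] that A by (simp add: c_def carrier_Gamma mat_transp_def)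
  moreover have "infinite {i. \<forall>j. c i j \<noteq> x}" "infinite {j. \<forall>i. c i j \<noteq> x}" for x
  proof -
    \<comment> \<open>A row or column whose parity differs from the one recorded in \<open>x\<close>
      avoids the colour \<open>x\<close> altogether, at zero entries too.\<close>
    have "{i. i mod 2 \<noteq> fst (snd (snd x))} \<subseteq> {i. \<forall>j. c i j \<noteq> x}"
      "{j. j mod 2 \<noteq> snd (snd (snd x))} \<subseteq> {j. \<forall>i. c i j \<noteq> x}"
      by (auto simp: c_def)
    then show "infinite {i. \<forall>j. c i j \<noteq> x}" "infinite {j. \<forall>i. c i j \<noteq> x}"
      using infinite_residue_ne infinite_super by blast+
  qed
  ultimately show ?thesis by (rule that)
qed


section \<open>Coinvariants\<close>

lemma Emb_bij_total: "Emb_bij \<subseteq> Emb_total"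
  by (auto simp: Emb_bij_def)

lemma Emb_total_Emb: "Emb_total \<subseteq> Emb"
  by (auto simp: Emb_total_def)

context
  fixes M :: "(imat, 'm, 'd) module_scheme"
  assumes Gamma_M: "left_module Gamma M"
begin

interpretation left_module Gamma M by (rule Gamma_M)

lemma push_closed: "\<lbrakk>f \<in> Emb; m \<in> carrier M\<rbrakk> \<Longrightarrow> push M f m \<in> carrier M"
  by (simp add: push_def U_closed)

lemma coinv_relations_closed:
  "S \<subseteq> Emb \<Longrightarrow> {m \<ominus>\<^bsub>M\<^esub> push M f m | m f. m \<in> carrier M \<and> f \<in> S} \<subseteq> carrier M"
  by (auto intro!: push_closed)

lemma subgroup_coinv_null: "S \<subseteq> Emb \<Longrightarrow> subgroup (coinv_null M S) (add_monoid M)"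
  unfolding coinv_null_def by (rule M.add.generate_is_subgroup[OF coinv_relations_closed])

lemma comm_group_coinvariants: "S \<subseteq> Emb \<Longrightarrow> comm_group (coinvariants M S)"
  unfolding coinvariants_def by (rule M.add.abelian_FactGroup[OF subgroup_coinv_null])

lemma coinv_map_epi: "S \<subseteq> Emb \<Longrightarrow> coinv_map M S \<in> epi (add_monoid M) (coinvariants M S)"
  unfolding coinvariants_def coinv_map_def[abs_def] by (rule M.add.rcoset_epi[OF subgroup_coinv_null])

lemma kernel_coinv_map:
  "S \<subseteq> Emb \<Longrightarrow> kernel (add_monoid M) (coinvariants M S) (coinv_map M S) = coinv_null M S"
  unfolding coinvariants_def coinv_map_def[abs_def] by (rule M.add.kernel_rcoset[OF subgroup_coinv_null])

lemma coinv_map_push: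
  assumes "S \<subseteq> Emb" "f \<in> S" "m \<in> carrier M"
  shows "coinv_map M S (push M f m) = coinv_map M S m"
  unfolding coinv_map_def
proof (rule comm_group.rcoset_cong[OF M.a_comm_group subgroup_coinv_null[OF assms(1)], symmetric])
  have "m \<ominus>\<^bsub>M\<^esub> push M f m \<in> coinv_null M S"
    unfolding coinv_null_def using assms by (intro generate.incl) blast
  then show "m \<otimes>\<^bsub>add_monoid M\<^esub> inv\<^bsub>add_monoid M\<^esub> push M f m \<in> coinv_null M S"
    by (simp add: a_minus_def a_inv_def)
qed (use assms push_closed in auto)

lemma coinv_map_add:
  assumes "S \<subseteq> Emb" "x \<in> carrier M" "y \<in> carrier M"
  shows "coinv_map M S (x \<oplus>\<^bsub>M\<^esub> y) = coinv_map M S x \<otimes>\<^bsub>coinvariants M S\<^esub> coinv_map M S y"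
  using coinv_map_epi[OF assms(1)] assms by (simp add: epi_def hom_def)

lemma coinv_map_closed:
  "\<lbrakk>S \<subseteq> Emb; x \<in> carrier M\<rbrakk> \<Longrightarrow> coinv_map M S x \<in> carrier (coinvariants M S)"
  using coinv_map_epi[of S] by (auto simp: epi_def hom_def)

lemma diag_smult_add:
  assumes "p \<in> carrier P_mod" "q \<in> carrier P_mod" "m \<in> carrier M"
  shows "diag (\<lambda>n. p n + q n) \<odot>\<^bsub>M\<^esub> m = diag p \<odot>\<^bsub>M\<^esub> m \<oplus>\<^bsub>M\<^esub> diag q \<odot>\<^bsub>M\<^esub> m"
proof -
  have "diag (\<lambda>n. p n + q n) = diag p \<oplus>\<^bsub>Gamma\<^esub> diag q"
    by (auto simp: diag_def Gamma_def fun_eq_iff)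
  then show ?thesis using assms by (simp add: smult_l_distr diag_closed)
qed

text \<open>For a product of \<open>U g\<close> and a diagonal matrix with \<open>g\<close>
  bijective, the factor \<open>U g\<close> disappears in the coinvariants. Both sides are additive
  in \<open>A\<close>, so a finite splitting into such products gives the general case.\<close>

lemma coinv_map_smult:
  assumes A: "A \<in> carrier Gamma" and m: "m \<in> carrier M"
  shows "coinv_map M Emb_bij (A \<odot>\<^bsub>M\<^esub> m) = coinv_map M Emb_bij (diag (column_sums A) \<odot>\<^bsub>M\<^esub> m)"
proof -
  let ?\<pi> = "coinv_map M Emb_bij"
  have E: "Emb_bij \<subseteq> Emb" using Emb_bij_total Emb_total_Emb by blast
  obtain c :: "nat \<Rightarrow> nat \<Rightarrow> nat \<times> nat \<times> nat \<times> nat"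
    where fin: "finite {c i j | i j. A i j \<noteq> 0}"
      and row: "\<And>i j k. \<lbrakk>A i j \<noteq> 0; A i k \<noteq> 0; c i j = c i k\<rbrakk> \<Longrightarrow> j = k"
      and col: "\<And>i j k. \<lbrakk>A i k \<noteq> 0; A j k \<noteq> 0; c i k = c j k\<rbrakk> \<Longrightarrow> i = j"
      and inf: "\<And>x. infinite {i. \<forall>j. c i j \<noteq> x}" "\<And>x. infinite {j. \<forall>i. c i j \<noteq> x}"
    by (rule monomial_colouring[OF A]) (blast intro: that)
  \<comment> \<open>Indexing by sets of colours turns the splitting of \<open>A\<close> into an
    induction over a finite set.\<close>
  define B where "B C = (\<lambda>i j. if c i j \<in> C then A i j else 0)" for C
  have B: "B C \<in> carrier Gamma" for C
    by (rule Gamma_restrict[OF A]) (simp add: B_def)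
  have single: "?\<pi> (B {x} \<odot>\<^bsub>M\<^esub> m) = ?\<pi> (diag (column_sums (B {x})) \<odot>\<^bsub>M\<^esub> m)" for x
  proof -
    obtain g where g: "g \<in> Emb_bij" "B {x} = mat_mult (U g) (diag (column_sums (B {x})))"
    proof (rule monomial_factorization[of "B {x}"])
      show "infinite {i. \<forall>j. B {x} i j = 0}"
        by (rule infinite_super[OF _ inf(1)[of x]]) (auto simp: B_def)
      show "infinite {j. \<forall>i. B {x} i j = 0}"
        by (rule infinite_super[OF _ inf(2)[of x]]) (auto simp: B_def)
    qed (auto simp: B_def split: if_splits intro: row col)
    have d: "diag (column_sums (B {x})) \<in> carrier Gamma"
      using column_sums_closed[OF B] by (simp add: diag_closed)
    have "B {x} = U g \<otimes>\<^bsub>Gamma\<^esub> diag (column_sums (B {x}))"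
      using g(2) by (simp add: Gamma_def)
    then have "B {x} \<odot>\<^bsub>M\<^esub> m = push M g (diag (column_sums (B {x})) \<odot>\<^bsub>M\<^esub> m)"
      using smult_assoc1[of "U g" "diag (column_sums (B {x}))" m] g(1) E d m
      by (auto simp: push_def U_closed)
    then show ?thesis using coinv_map_push[OF E g(1)] d m by simp
  qed
  have "?\<pi> (B C \<odot>\<^bsub>M\<^esub> m) = ?\<pi> (diag (column_sums (B C)) \<odot>\<^bsub>M\<^esub> m)" if "finite C" for C
    using that
  proof induction
    case empty
    \<comment> \<open>Both are the zero matrix, so no evaluation in \<open>M\<close> is
      required.\<close>
    have "diag (column_sums (B {})) = B {}"
      by (auto simp: B_def diag_def column_sums_def mat_vec_def mat_transp_def)
    then show ?case by simp
  next
    case (insert x C)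
    \<comment> \<open>Since \<open>x\<close> is not in \<open>C\<close>, no entry is counted
      twice.\<close>
    have eq: "B (insert x C) = (\<lambda>i j. B {x} i j + B C i j)"
      using insert.hyps by (auto simp: B_def fun_eq_iff)
    then have "B (insert x C) = B {x} \<oplus>\<^bsub>Gamma\<^esub> B C" by (simp add: Gamma_def)
    then have "?\<pi> (B (insert x C) \<odot>\<^bsub>M\<^esub> m)
        = ?\<pi> (B {x} \<odot>\<^bsub>M\<^esub> m) \<otimes>\<^bsub>coinvariants M Emb_bij\<^esub> ?\<pi> (B C \<odot>\<^bsub>M\<^esub> m)"
      using B m E by (simp add: smult_l_distr coinv_map_add)
    also have "\<dots> = ?\<pi> (diag (column_sums (B {x})) \<odot>\<^bsub>M\<^esub> m \<oplus>\<^bsub>M\<^esub> diag (column_sums (B C)) \<odot>\<^bsub>M\<^esub> m)"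
      using B m E single insert.IH by (simp add: coinv_map_add diag_closed column_sums_closed)
    also have "\<dots> = ?\<pi> (diag (column_sums (B (insert x C))) \<odot>\<^bsub>M\<^esub> m)"
      using B m unfolding eq
      by (simp add: column_sums_add diag_smult_add column_sums_closed)
    finally show ?case .
  qed
  \<comment> \<open>Entries whose colour is missing from this set are zero already.\<close>
  moreover have "B {c i j | i j. A i j \<noteq> 0} = A" by (auto simp: B_def fun_eq_iff)
  ultimately show ?thesis using fin by fastforce
qed


section \<open>Comparison with the tensor product\<close>

lemma right_act_closed: "\<lbrakk>m \<in> carrier M; A \<in> carrier Gamma\<rbrakk> \<Longrightarrow> right_act M m A \<in> carrier M"
  by (simp add: right_act_def mat_transp_closed)

interpretation H: tensor_setup Gamma M "right_act M" P_mod
  by (rule tensor_setup.intro[OF M.abelian_group_axioms left_module_P_mod right_act_closed])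

lemma one_P_mod_closed: "\<one>\<^bsub>P_mod\<^esub> \<in> carrier P_mod"
  by (simp add: P_mod_def)

lemma H0_map_hom: "H0_map M \<in> hom (add_monoid M) (H0 M)"
proof (rule homI)
  fix x y assume "x \<in> carrier (add_monoid M)" "y \<in> carrier (add_monoid M)"
  then show "H0_map M (x \<otimes>\<^bsub>add_monoid M\<^esub> y) = H0_map M x \<otimes>\<^bsub>H0 M\<^esub> H0_map M y"
    unfolding H0_map_def H0_def using H.tensor_elem_add_left one_P_mod_closed by simp
next
  fix x assume "x \<in> carrier (add_monoid M)"
  then show "H0_map M x \<in> carrier (H0 M)"
    unfolding H0_map_def H0_def using H.tensor_elem_closed one_P_mod_closed by simp
qed

text \<open>The constant sequence 1 generates \<open>P_mod\<close>: balancing moves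
  \<open>diag p\<close> across the tensor sign, so every pure tensor is an image, and pure tensors
  generate.\<close>

lemma H0_map_epi: "H0_map M \<in> epi (add_monoid M) (H0 M)"
proof -
  interpret Q: comm_group "H0 M"
    unfolding H0_def by (rule H.comm_group_tensor_product)
  interpret h: group_hom "add_monoid M" "H0 M" "H0_map M"
    by unfold_locales (rule H0_map_hom)
  have "carrier (H0 M) \<subseteq> H0_map M ` carrier (add_monoid M)"
    unfolding H0_def
  proof (rule H.tensor_product_generated)
    show "subgroup (H0_map M ` carrier (add_monoid M)) (tensor_product Gamma M (right_act M) P_mod)"
      using h.img_is_subgroup by (simp add: H0_def)
    fix x p assume x: "x \<in> carrier M" and p: "p \<in> carrier P_mod"
    have "diag p \<odot>\<^bsub>P_mod\<^esub> \<one>\<^bsub>P_mod\<^esub> = p"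
      by (simp add: P_mod_def mat_vec_diag)
    then have "tensor_elem Gamma M (right_act M) P_mod x p = H0_map M (right_act M x (diag p))"
      using H.tensor_elem_balanced[of x "diag p" "\<one>\<^bsub>P_mod\<^esub>"] x p one_P_mod_closed
      by (simp add: H0_map_def diag_closed)
    then show "tensor_elem Gamma M (right_act M) P_mod x p \<in> H0_map M ` carrier (add_monoid M)"
      using x p by (simp add: right_act_closed diag_closed)
  qed
  then show ?thesis
    using H0_map_hom h.hom_closed by (auto simp: epi_def)
qed

text \<open>The transpose of \<open>U f\<close> fixes the constant sequence 1 when \<open>f\<close>
  is total. Balancing with this transpose therefore identifies the images of \<open>m\<close> and
  \<open>push M f m\<close>.\<close>

lemma coinv_null_total_le_kernel_H0:
  "coinv_null M Emb_total \<subseteq> kernel (add_monoid M) (H0 M) (H0_map M)"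
proof -
  interpret Q: comm_group "H0 M"
    unfolding H0_def by (rule H.comm_group_tensor_product)
  interpret h: group_hom "add_monoid M" "H0 M" "H0_map M"
    by unfold_locales (rule H0_map_hom)
  show ?thesis
    unfolding coinv_null_def
  proof (rule M.add.generate_subgroup_incl[OF _ h.subgroup_kernel], safe)
    fix m f assume m: "m \<in> carrier M" and f: "f \<in> Emb_total"
    then have fE: "f \<in> Emb" by (simp add: Emb_total_def)
    have f_total: "f j \<noteq> None" for j using f by (auto simp: Emb_total_def)
    \<comment> \<open>Totality enters here: row \<open>j\<close> of the transpose has exactly one
      entry 1, in column \<open>the (f j)\<close>.\<close>
    have "mat_vec (mat_transp (U f)) (\<lambda>n. 1) j = 1" for j
    proof -
      have "mat_vec (mat_transp (U f)) (\<lambda>n. 1) j = (\<Sum>i\<in>{the (f j)}. mat_transp (U f) j i * 1)"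
        by (rule mat_vec_eq) (auto simp: mat_transp_def U_def split: if_splits)
      then show ?thesis using f_total[of j] by (simp add: mat_transp_def U_def)
    qed
    then have "mat_transp (U f) \<odot>\<^bsub>P_mod\<^esub> \<one>\<^bsub>P_mod\<^esub> = \<one>\<^bsub>P_mod\<^esub>"
      by (simp add: P_mod_def fun_eq_iff)
    \<comment> \<open>The right action transposes once more, which gives back
      \<open>U f\<close>.\<close>
    moreover have "right_act M m (mat_transp (U f)) = push M f m"
      by (simp add: right_act_def push_def)
    ultimately have "H0_map M (push M f m) = H0_map M m"
      using H.tensor_elem_balanced[of m "mat_transp (U f)" "\<one>\<^bsub>P_mod\<^esub>"] m fE one_P_mod_closed
      by (simp add: H0_map_def U_closed mat_transp_closed)
    moreover have "H0_map M (m \<ominus>\<^bsub>M\<^esub> push M f m)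
        = H0_map M m \<otimes>\<^bsub>H0 M\<^esub> inv\<^bsub>H0 M\<^esub> H0_map M (push M f m)"
      using h.hom_mult[of m "\<ominus>\<^bsub>M\<^esub> push M f m"] h.hom_inv[of "push M f m"] m push_closed[OF fE m]
      by (simp add: a_minus_def a_inv_def[symmetric])
    moreover have "H0_map M m \<in> carrier (H0 M)" using h.hom_closed m by simp
    ultimately show "m \<ominus>\<^bsub>M\<^esub> push M f m \<in> kernel (add_monoid M) (H0 M) (H0_map M)"
      using m push_closed[OF fE m] by (simp add: kernel_def)
  qed
qed

text \<open>The map \<open>?\<phi>\<close> below is biadditive and balanced, so it respects
  vanishing of tensors. At the constant sequence 1 it returns the class of \<open>m\<close>.\<close>

lemma kernel_H0_le_coinv_null_bij:
  "kernel (add_monoid M) (H0 M) (H0_map M) \<subseteq> coinv_null M Emb_bij"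
proof
  fix m assume "m \<in> kernel (add_monoid M) (H0 M) (H0_map M)"
  then have m: "m \<in> carrier M" "H0_map M m = \<one>\<^bsub>H0 M\<^esub>" by (auto simp: kernel_def)
  let ?\<phi> = "\<lambda>x p. coinv_map M Emb_bij (diag p \<odot>\<^bsub>M\<^esub> x)"
  have E: "Emb_bij \<subseteq> Emb" using Emb_bij_total Emb_total_Emb by blast
  have "?\<phi> m \<one>\<^bsub>P_mod\<^esub> = \<one>\<^bsub>coinvariants M Emb_bij\<^esub>"
  proof (rule H.tensor_elem_eq_one[OF comm_group_coinvariants[OF E], of ?\<phi>])
    fix x p q assume "x \<in> carrier M" "p \<in> carrier P_mod" "q \<in> carrier P_mod"
    moreover have "p \<oplus>\<^bsub>P_mod\<^esub> q = (\<lambda>n. p n + q n)" by (simp add: P_mod_def)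
    ultimately show "?\<phi> x (p \<oplus>\<^bsub>P_mod\<^esub> q) = ?\<phi> x p \<otimes>\<^bsub>coinvariants M Emb_bij\<^esub> ?\<phi> x q"
      using E by (simp add: diag_smult_add coinv_map_add diag_closed)
  next
    fix x A p assume *: "x \<in> carrier M" "A \<in> carrier Gamma" "p \<in> carrier P_mod"
    \<comment> \<open>Acting by \<open>A\<close> on the right and then by \<open>diag p\<close> on
      the left is the left action of this one matrix. Its transpose is A times
      \<open>diag p\<close>, so its column sums are A applied to \<open>p\<close>, and
      \<open>coinv_map_smult\<close> yields the balancing identity.\<close>
    let ?B = "diag p \<otimes>\<^bsub>Gamma\<^esub> mat_transp A"
    have B: "?B \<in> carrier Gamma" using * by (simp add: diag_closed mat_transp_closed)
    have "column_sums ?B = mat_vec (mat_mult A (diag p)) (\<lambda>n. 1)"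
      by (simp add: column_sums_def Gamma_def mat_transp_mult mat_transp_diag)
    also have "\<dots> = A \<odot>\<^bsub>P_mod\<^esub> p"
      using * by (simp add: mat_vec_mult carrier_Gamma bounded_rows_diag mat_vec_diag P_mod_def)
    finally have cs: "column_sums ?B = A \<odot>\<^bsub>P_mod\<^esub> p" .
    have "diag p \<odot>\<^bsub>M\<^esub> right_act M x A = ?B \<odot>\<^bsub>M\<^esub> x"
      using * by (simp add: right_act_def smult_assoc1 diag_closed mat_transp_closed)
    then show "?\<phi> (right_act M x A) p = ?\<phi> x (A \<odot>\<^bsub>P_mod\<^esub> p)"
      using coinv_map_smult[OF B *(1)] by (simp add: cs)
  qed (use m E in \<open>simp_all add: H0_map_def H0_def one_P_mod_closed coinv_map_closed
      coinv_map_add smult_r_distr diag_closed\<close>)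
  moreover have "diag \<one>\<^bsub>P_mod\<^esub> = \<one>\<^bsub>Gamma\<^esub>"
    by (simp add: P_mod_def Gamma_def diag_def fun_eq_iff)
  ultimately show "m \<in> coinv_null M Emb_bij"
    using m kernel_coinv_map[OF E] by (auto simp: kernel_def)
qed

lemma coinv_null_bij_le_total: "coinv_null M Emb_bij \<subseteq> coinv_null M Emb_total"
  unfolding coinv_null_def by (rule M.add.mono_generate) (use Emb_bij_total in blast)

end

theorem proposition6p2p3:
  fixes M :: "(imat, 'm) module"
  assumes "left_module Gamma M"
  shows "H0_map M \<in> epi (add_monoid M) (H0 M)
       \<and> coinv_map M Emb_total \<in> epi (add_monoid M) (coinvariants M Emb_total)
       \<and> coinv_map M Emb_bij \<in> epi (add_monoid M) (coinvariants M Emb_bij)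
       \<and> kernel (add_monoid M) (H0 M) (H0_map M)
           = kernel (add_monoid M) (coinvariants M Emb_total) (coinv_map M Emb_total)
       \<and> kernel (add_monoid M) (coinvariants M Emb_total) (coinv_map M Emb_total)
           = kernel (add_monoid M) (coinvariants M Emb_bij) (coinv_map M Emb_bij)"
proof -
  have E: "Emb_total \<subseteq> Emb" "Emb_bij \<subseteq> Emb"
    using Emb_bij_total Emb_total_Emb by blast+
  \<comment> \<open>The three kernels agree by a cycle of inclusions: the null subgroup for
    \<open>Emb_total\<close> lies in the kernel of \<open>H0_map\<close>, which lies in the null
    subgroup for \<open>Emb_bij\<close>, which lies in the first.\<close>
  show ?thesis
    using H0_map_epi[OF assms] coinv_map_epi[OF assms E(1)] coinv_map_epi[OF assms E(2)]
      kernel_coinv_map[OF assms E(1)] kernel_coinv_map[OF assms E(2)]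
      coinv_null_total_le_kernel_H0[OF assms] kernel_H0_le_coinv_null_bij[OF assms]
      coinv_null_bij_le_total[OF assms]
    by auto
qed

end
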